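(* For every $z\in U$ there exists a sequence $(b_n)_{n\ge 1}$ with $b_n\in\mathcal J$ for all $n\ge 1$ such that, defining $p_{-1}=1,\ p_0=0,\ q_{-1}=0,\ q_0=1$ and $$p_{n+1}=b_{n+1}p_n+p_{n-1},\qquad q_{n+1}=b_{n+1}q_n+q_{n-1}\qquad (n\ge 0),$$ one has $$z=\lim_{n\to\infty}\frac{p_n}{q_n}.$$
   Context: Let $\zeta=\frac{1+\sqrt{-3}}2$, $\mathfrak o(\sqrt{-3})=\mathbb Z+\mathbb Z\zeta$ (the ring of integers of $\mathbb Q(\sqrt{-3})$), $\eta=\frac{3+\sqrt{-3}}2$, and $\mathcal J=\eta\cdot\mathfrak o(\sqrt{-3})=\{\eta a: a\in\mathfrak o(\sqrt{-3})\}$. $U$ is the fundamental domain of $\mathbb C/\mathcal J$ consisting of the open regular hexagon with vertices $\zeta^k$, $0\le k\le 5$ (i.e. $\pm1,\pm\zeta,\pm\overline\zeta$), together with the three open sides $\{t\zeta+(1-t)(-\overline\zeta):0<t<1\}$, $\{t(-\zeta)+(1-t)(-1):0<t<1\}$, $\{t+(1-t)\overline\zeta:0<t<1\}$ and the two vertices $-\zeta$ and $\overline\zeta$. *)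

theory Defs
  imports "HOL-Analysis.Analysis"
begin

definition zeta :: complex where
  "zeta = (1 + \<i> * complex_of_real (sqrt 3)) / 2"

definition eta :: complex where
  "eta = (3 + \<i> * complex_of_real (sqrt 3)) / 2"

definition eisenstein_ints :: "complex set" where
  "eisenstein_ints = {of_int m + of_int n * zeta | m n :: int. True}"

definition J :: "complex set" where
  "J = {eta * a | a. a \<in> eisenstein_ints}"

definition open_hexagon :: "complex set" where
  "open_hexagon = interior (convex hull {zeta ^ k | k :: nat. k \<le> 5})"

definition U :: "complex set" where
  "U = open_hexagon
     \<union> open_segment zeta (- cnj zeta)
     \<union> open_segment (- zeta) (- 1)
     \<union> open_segment 1 (cnj zeta)
     \<union> {- zeta, cnj zeta}"

text \<open>
  The sequence \<open>x\<^sub>0, x\<^sub>1, \<dots>\<close> with \<open>x\<^sub>n\<^sub>+\<^sub>1 = b\<^sub>n\<^sub>+\<^sub>1 x\<^sub>n + x\<^sub>n\<^sub>-\<^sub>1\<close>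
  for \<open>n \<ge> 0\<close>. The first argument is the initial value at index \<open>-1\<close>, the second the one at
  index \<open>0\<close>. The value \<open>b 0\<close> is never used.
\<close>

fun cf_rec :: "complex \<Rightarrow> complex \<Rightarrow> (nat \<Rightarrow> complex) \<Rightarrow> nat \<Rightarrow> complex" where
  "cf_rec u v b 0 = v"
| "cf_rec u v b (Suc 0) = b (Suc 0) * v + u"
| "cf_rec u v b (Suc (Suc n)) = b (Suc (Suc n)) * cf_rec u v b (Suc n) + cf_rec u v b n"

definition cf_p :: "(nat \<Rightarrow> complex) \<Rightarrow> nat \<Rightarrow> complex" where
  "cf_p = cf_rec 1 0"

definition cf_q :: "(nat \<Rightarrow> complex) \<Rightarrow> nat \<Rightarrow> complex" where
  "cf_q = cf_rec 0 1"

end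

theory Submission
  imports Defs
begin

text \<open>
  Expand \<open>1/z\<^sub>n = b\<^sub>n\<^sub>+\<^sub>1 + z\<^sub>n\<^sub>+\<^sub>1\<close> with \<open>b\<^sub>n\<^sub>+\<^sub>1 \<in> J\<close> and \<open>z\<^sub>n\<^sub>+\<^sub>1\<close> in the closed hexagon, which meets the
  unit circle only in its vertices. Since \<open>q\<^sub>n z - p\<^sub>n = \<plusminus> z\<^sub>0 \<dots> z\<^sub>n\<close>, as long as \<open>0 < |z\<^sub>n| < 1\<close> the
  pairs \<open>(p\<^sub>n, q\<^sub>n)\<close> of Eisenstein integers are pairwise distinct and satisfy \<open>|q\<^sub>n z - p\<^sub>n| \<le> 1\<close>; by
  discreteness \<open>|q\<^sub>n|\<close> tends to infinity, and the expansion converges.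

  It remains to expand \<open>0\<close> and the vertices. For \<open>0\<close> the digits \<open>c, 0, c, 0, \<dots>\<close> work: the convergents
  alternate between \<open>0\<close> and \<open>1/(kc)\<close>. At a vertex, always taking the remainder in \<open>U\<close> gives a constant
  digit sequence, whose convergents are periodic. But a vertex is a cusp: in the coordinate
  \<open>1/(w - 1)\<close> the convergents of an expansion of \<open>1\<close> with all remainders vertices walk along the
  edges of a honeycomb, and digits that turn left and right alternately make the walk escape to
  infinity.
\<close>

text \<open>Division by zero yields 0, so the condition on \<open>cf_q\<close> ensures that the
  limit is taken over genuine quotients.\<close>

definition cf_expandable :: "complex \<Rightarrow> bool" where
  "cf_expandable z \<longleftrightarrow> (\<exists>b :: nat \<Rightarrow> complex. (\<forall>n\<ge>1. b n \<in> J) \<and>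
           (\<forall>\<^sub>F n in sequentially. cf_q b n \<noteq> 0) \<and>
           (\<lambda>n. cf_p b n / cf_q b n) \<longlonglongrightarrow> z)"

text \<open>A primitive cube root of unity generating the same ring as \<open>zeta\<close>; its
  quadratic relation makes most later identities purely algebraic.\<close>

definition omega :: complex where
  "omega = zeta - 1"

lemma omega_sq: "omega\<^sup>2 = - 1 - omega"
  by (simp add: omega_def zeta_def complex_eq_iff power2_eq_square field_simps)

lemma omega_cube: "omega ^ 3 = 1"
  using omega_sq by algebra

lemma Re_omega: "Re omega = - 1 / 2"
  by (simp add: omega_def zeta_def)

lemma norm_omega: "norm omega = 1"
  by (simp add: omega_def zeta_def cmod_def power2_eq_square field_simps)

subsection \<open>Eisenstein integers\<close>

lemma eisenstein_intsE:
  assumes "x \<in> eisenstein_ints"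
  obtains m n :: int where "x = of_int m + of_int n * omega"
proof -
  obtain m n :: int where "x = of_int m + of_int n * zeta"
    using assms by (auto simp: eisenstein_ints_def)
  hence "x = of_int (m + n) + of_int n * omega"
    by (simp add: omega_def algebra_simps)
  thus ?thesis
    using that by blast
qed

lemma eisenstein_intsI: "of_int m + of_int n * omega \<in> eisenstein_ints"
proof -
  have "of_int m + of_int n * omega = of_int (m - n) + of_int n * zeta"
    by (simp add: omega_def algebra_simps)
  thus ?thesis
    unfolding eisenstein_ints_def by blast
qed

lemma eisenstein_ints_0: "0 \<in> eisenstein_ints"
  and eisenstein_ints_1: "1 \<in> eisenstein_ints"
  and eisenstein_ints_omega: "omega \<in> eisenstein_ints"
  using eisenstein_intsI[of 0 0] eisenstein_intsI[of 1 0] eisenstein_intsI[of 0 1] by auto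

lemma eisenstein_ints_add:
  assumes "x \<in> eisenstein_ints" "y \<in> eisenstein_ints"
  shows "x + y \<in> eisenstein_ints"
proof -
  obtain a b c d :: int where "x = of_int a + of_int b * omega" "y = of_int c + of_int d * omega"
    using assms by (metis eisenstein_intsE)
  hence "x + y = of_int (a + c) + of_int (b + d) * omega"
    by (simp add: algebra_simps)
  thus ?thesis
    by (metis eisenstein_intsI)
qed

lemma eisenstein_ints_uminus:
  assumes "x \<in> eisenstein_ints"
  shows "- x \<in> eisenstein_ints"
proof -
  obtain a b :: int where "x = of_int a + of_int b * omega"
    using assms by (metis eisenstein_intsE)
  hence "- x = of_int (- a) + of_int (- b) * omega"
    by simp
  thus ?thesis
    by (metis eisenstein_intsI)
qed

lemma eisenstein_ints_mult:
  assumes "x \<in> eisenstein_ints" "y \<in> eisenstein_ints"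
  shows "x * y \<in> eisenstein_ints"
proof -
  obtain a b c d :: int where xy: "x = of_int a + of_int b * omega" "y = of_int c + of_int d * omega"
    using assms by (metis eisenstein_intsE)
  have "x * y = of_int a * of_int c + (of_int a * of_int d + of_int b * of_int c) * omega
      + of_int b * of_int d * omega\<^sup>2"
    by (simp add: xy algebra_simps power2_eq_square)
  also have "\<dots> = of_int (a * c - b * d) + of_int (a * d + b * c - b * d) * omega"
    by (simp add: omega_sq algebra_simps)
  finally show ?thesis
    by (metis eisenstein_intsI)
qed

lemma eisenstein_ints_power: "x \<in> eisenstein_ints \<Longrightarrow> x ^ n \<in> eisenstein_ints"
  by (induction n) (auto intro: eisenstein_ints_mult eisenstein_ints_1)

lemma finite_eisenstein_ints_norm_le: "finite {x \<in> eisenstein_ints. norm x \<le> R}"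
proof -
  define K where "K = \<lceil>3 * R\<rceil>"
  have "{x \<in> eisenstein_ints. norm x \<le> R}
      \<subseteq> (\<lambda>(m, n). of_int m + of_int n * zeta) ` ({- K..K} \<times> {- K..K})"
  proof safe
    fix x assume "x \<in> eisenstein_ints" and R: "norm x \<le> R"
    then obtain m n :: int where x: "x = of_int m + of_int n * zeta"
      by (auto simp: eisenstein_ints_def)
    \<comment> \<open>The imaginary part bounds \<open>n\<close>, and the real part then bounds
      \<open>m\<close>.\<close>
    have re: "\<bar>of_int m + of_int n / 2\<bar> \<le> R"
      using abs_Re_le_cmod[of x] R by (simp add: x zeta_def)
    have "\<bar>of_int n * (sqrt 3 / 2)\<bar> \<le> R"
      using abs_Im_le_cmod[of x] R by (simp add: x zeta_def)
    moreover have "\<bar>of_int n\<bar> * (1 / 2) \<le> \<bar>of_int n\<bar> * (sqrt 3 / 2)"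
      by (intro mult_left_mono) auto
    ultimately have n: "\<bar>of_int n\<bar> \<le> 2 * R"
      by (simp add: abs_mult)
    have m: "\<bar>of_int m\<bar> \<le> 2 * R"
      using re n by linarith
    have "of_int \<bar>n\<bar> \<le> 3 * R" "of_int \<bar>m\<bar> \<le> 3 * R"
      using m n by auto
    hence "\<bar>n\<bar> \<le> K" "\<bar>m\<bar> \<le> K"
      unfolding K_def by linarith+
    thus "x \<in> (\<lambda>(m, n). of_int m + of_int n * zeta) ` ({- K..K} \<times> {- K..K})"
      using x by (intro image_eqI[of _ _ "(m, n)"]) auto
  qed
  thus ?thesis
    by (rule finite_subset) auto
qed

subsection \<open>The lattice\<close>

lemma eta_eq: "eta = 2 + omega"
  by (simp add: eta_def omega_def zeta_def complex_eq_iff)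

lemma J_0: "0 \<in> J"
  unfolding J_def using eisenstein_ints_0 by force

lemma J_mult: "x \<in> J \<Longrightarrow> y \<in> eisenstein_ints \<Longrightarrow> y * x \<in> J"
  unfolding J_def by (force intro: eisenstein_ints_mult)

lemma J_uminus:
  assumes "x \<in> J"
  shows "- x \<in> J"
  using J_mult[OF assms eisenstein_ints_uminus[OF eisenstein_ints_1]] by simp

lemma J_subset_eisenstein: "x \<in> J \<Longrightarrow> x \<in> eisenstein_ints"
  using eisenstein_intsI[of 2 1] by (auto simp: J_def eta_eq intro: eisenstein_ints_mult)

text \<open>\<open>1 - omega\<close> is an associate of \<open>eta\<close>; all explicit digits
  below are multiples of it.\<close>

lemma one_minus_omega_in_J: "1 - omega \<in> J"
proof -
  have "eta * - omega = 1 - omega"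
    unfolding eta_eq using omega_sq by algebra
  moreover have "- omega \<in> eisenstein_ints"
    by (simp add: eisenstein_ints_uminus eisenstein_ints_omega)
  ultimately show ?thesis
    unfolding J_def by force
qed

lemma omega_sq_minus_omega_in_J: "omega\<^sup>2 - omega \<in> J"
proof -
  have "omega\<^sup>2 - omega = - (omega * (1 - omega))"
    by (simp add: algebra_simps power2_eq_square)
  thus ?thesis
    using J_mult[OF one_minus_omega_in_J eisenstein_ints_omega] J_uminus by metis
qed

text \<open>Since \<open>eta * zeta\<close> is \<open>\<i> * sqrt 3\<close>, the element
  \<open>eta * (a + (k - a) * zeta)\<close> has coordinates \<open>a\<close> and
  \<open>2 * k - a\<close>.\<close>

lemma J_even_coordinates:
  assumes "even (a + c)"
  shows "Complex (3 / 2 * of_int a) (sqrt 3 / 2 * of_int c) \<in> J"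
proof -
  obtain k where "a + c = 2 * k"
    using assms by blast
  hence c: "c = 2 * k - a"
    by simp
  have "Complex (3 / 2 * of_int a) (sqrt 3 / 2 * of_int c)
      = eta * (of_int a + of_int (k - a) * zeta)"
    by (simp add: c complex_eq_iff eta_def zeta_def field_simps)
  thus ?thesis
    unfolding J_def eisenstein_ints_def by blast
qed

subsection \<open>Reduction modulo the lattice\<close>

definition vertices :: "complex set" where
  "vertices = {1, omega, omega\<^sup>2, - 1, - omega, - omega\<^sup>2}"

text \<open>For the point \<open>(3/2 * s, sqrt 3/2 * t)\<close> of a quarter hexagon,
  \<open>9 * s\<^sup>2 + 3 * t\<^sup>2 < 4\<close> means norm below 1. By
  \<open>3 * s \<le> 2 - t\<close> the left side is at most \<open>4 - 4 * t * (1 - t)\<close>, so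
  only \<open>t = 0\<close> and \<open>t = 1\<close> can give equality.\<close>

lemma quarter_hexagon:
  fixes s t :: real
  assumes "0 \<le> s" "0 \<le> t" "t \<le> 1" "3 * s + t \<le> 2"
  shows "9 * s\<^sup>2 + 3 * t\<^sup>2 < 4 \<or> (s = 2 / 3 \<and> t = 0) \<or> (s = 1 / 3 \<and> t = 1)"
proof (cases "t = 0 \<or> t = 1")
  case True
  hence "(s = 2 / 3 \<and> t = 0) \<or> (s = 1 / 3 \<and> t = 1) \<or> 3 * s < 2 - t"
    using assms(4) by auto
  moreover have "9 * s\<^sup>2 + 3 * t\<^sup>2 < 4" if "3 * s < 2 - t"
  proof -
    have "(3 * s)\<^sup>2 < (2 - t)\<^sup>2"
      using that assms(1) by (intro power_strict_mono) auto
    thus ?thesis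
      using True by (auto simp: power2_eq_square)
  qed
  ultimately show ?thesis
    by blast
next
  case False
  have "(3 * s)\<^sup>2 \<le> (2 - t)\<^sup>2"
    using assms by (intro power_mono) auto
  moreover have "0 < t * (1 - t)"
    using False assms by (intro mult_pos_pos) auto
  ultimately show ?thesis
    by (simp add: power2_eq_square algebra_simps)
qed

lemma hexagon_scaled:
  assumes "0 \<le> s" "0 \<le> t" "t \<le> 1" "3 * s + t \<le> 2" "\<bar>x\<bar> = 3 / 2 * s" "\<bar>y\<bar> = sqrt 3 / 2 * t"
  shows "norm (Complex x y) < 1 \<or> Complex x y \<in> vertices"
proof -
  have x2: "x\<^sup>2 = (3 / 2 * s)\<^sup>2" and y2: "y\<^sup>2 = (sqrt 3 / 2 * t)\<^sup>2"
    using assms(5,6) by (metis power2_abs)+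
  have "x\<^sup>2 + y\<^sup>2 = (9 * s\<^sup>2 + 3 * t\<^sup>2) / 4"
    unfolding x2 y2 by (simp add: power_mult_distrib power_divide)
  hence norm: "norm (Complex x y) = sqrt ((9 * s\<^sup>2 + 3 * t\<^sup>2) / 4)"
    by (simp add: cmod_def)
  consider "9 * s\<^sup>2 + 3 * t\<^sup>2 < 4" | "s = 2 / 3" "t = 0" | "s = 1 / 3" "t = 1"
    using quarter_hexagon[OF assms(1-4)] by blast
  thus ?thesis
  proof cases
    case 1
    hence "norm (Complex x y) < 1"
      unfolding norm by (subst real_sqrt_lt_1_iff) auto
    thus ?thesis ..
  next
    case 2
    hence "(x = 1 \<or> x = - 1) \<and> y = 0"
      using assms(5,6) by auto
    hence "Complex x y \<in> {1, - 1}"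
      by (auto simp: complex_eq_iff)
    thus ?thesis
      by (auto simp: vertices_def)
  next
    case 3
    hence "(x = 1 / 2 \<or> x = - 1 / 2) \<and> (y = sqrt 3 / 2 \<or> y = - sqrt 3 / 2)"
      using assms(5,6) by (auto simp: abs_if split: if_splits)
    hence "Complex x y \<in> {omega, - 1 - omega, - omega, - (- 1 - omega)}"
      by (auto simp: complex_eq_iff omega_def zeta_def)
    thus ?thesis
      unfolding vertices_def omega_sq by blast
  qed
qed

text \<open>In the coordinates \<open>X = 2/3 Re w\<close> and \<open>Y = 2/\<surd>3 Im w\<close> the lattice consists of the integer points
  with even coordinate sum. Two opposite corners of the unit square around a point belong to it,
  and the Voronoi cell of one of them contains the point.\<close>

lemma exists_remainder:
  "\<exists>b \<in> J. norm (w - b) < 1 \<or> w - b \<in> vertices"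
proof -
  define X where "X = 2 / 3 * Re w"
  define Y where "Y = 2 / sqrt 3 * Im w"
  define s where "s = frac X"
  define t where "t = frac Y"
  define a where "a = \<lfloor>X\<rfloor>"
  define c where "c = \<lfloor>Y\<rfloor>"
  have X: "X = of_int a + s" and Y: "Y = of_int c + t"
    by (simp_all add: a_def c_def s_def t_def frac_def)
  have st: "0 \<le> s" "s \<le> 1" "0 \<le> t" "t \<le> 1"
    by (auto simp: s_def t_def frac_ge_0 less_imp_le[OF frac_lt_1])
  have re: "Re w = 3 / 2 * (of_int a + s)" and im: "Im w = sqrt 3 / 2 * (of_int c + t)"
    using X Y by (auto simp: X_def Y_def field_simps)
  have reduce: ?thesis
    if "even (a' + c')" "\<bar>of_int a + s - of_int a'\<bar> = s'" "\<bar>of_int c + t - of_int c'\<bar> = t'"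
      "t' \<le> 1" "3 * s' + t' \<le> 2" for a' c' :: int and s' t' :: real
  proof -
    define b where "b = Complex (3 / 2 * of_int a') (sqrt 3 / 2 * of_int c')"
    have w: "w - b = Complex (3 / 2 * (of_int a + s - of_int a')) (sqrt 3 / 2 * (of_int c + t - of_int c'))"
      by (simp add: complex_eq_iff b_def re im algebra_simps)
    have "norm (w - b) < 1 \<or> w - b \<in> vertices"
      unfolding w using that by (intro hexagon_scaled[of s' t']) (auto simp: abs_mult)
    thus ?thesis
      using J_even_coordinates[OF that(1)] unfolding b_def by blast
  qed
  \<comment> \<open>For two opposite corners the values of \<open>3 * s' + t'\<close> add up to 4,
    so one of them is at most 2.\<close>
  show ?thesis
  proof (cases "even (a + c)")
    case True
    show ?thesis
    proof (cases "3 * s + t \<le> 2")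
      case True
      thus ?thesis
        using \<open>even (a + c)\<close> st by (intro reduce[of a c s t]) auto
    next
      case False
      thus ?thesis
        using \<open>even (a + c)\<close> st by (intro reduce[of "a + 1" "c + 1" "1 - s" "1 - t"]) auto
    qed
  next
    case False
    show ?thesis
    proof (cases "3 * (1 - s) + t \<le> 2")
      case True
      thus ?thesis
        using \<open>odd (a + c)\<close> st by (intro reduce[of "a + 1" c "1 - s" t]) auto
    next
      case False
      thus ?thesis
        using \<open>odd (a + c)\<close> st by (intro reduce[of a "c + 1" s "1 - t"]) auto
    qed
  qed
qed

text \<open>The hexagon is the hull of points on the unit circle, so its interior and its open sides
  lie in the open disc.\<close>

lemma U_subset:
  assumes "z \<in> U"
  shows "norm z < 1 \<or> z \<in> vertices"
proof -
  have nz: "norm zeta = 1"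
    by (simp add: zeta_def cmod_def power2_eq_square field_simps)
  have seg: "norm z < 1" if "z \<in> open_segment x y" "norm x = 1" "norm y = 1" for x y
    using dist_decreases_open_segment[OF that(1), of 0] that(2,3) by auto
  have hull: "convex hull {zeta ^ k | k :: nat. k \<le> 5} \<subseteq> cball 0 1"
    by (intro hull_minimal) (auto simp: norm_power nz)
  have "open_hexagon \<subseteq> ball 0 1"
    using interior_mono[OF hull] unfolding open_hexagon_def interior_cball .
  moreover have "- zeta = omega\<^sup>2" "cnj zeta = - omega"
    unfolding omega_sq by (simp_all add: omega_def zeta_def complex_eq_iff)
  hence "{- zeta, cnj zeta} \<subseteq> vertices"
    by (auto simp: vertices_def)
  moreover have "norm z < 1" if "z \<in> open_segment zeta (- cnj zeta) \<union> open_segment (- zeta) (- 1)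
      \<union> open_segment 1 (cnj zeta)"
    using that nz seg[of zeta "- cnj zeta"] seg[of "- zeta" "- 1"] seg[of 1 "cnj zeta"]
    by (auto simp del: complex_cnj_minus)
  ultimately show ?thesis
    using assms unfolding U_def by (auto simp: subset_iff)
qed

subsection \<open>Convergents\<close>

lemma cf_rec_in_eisenstein_ints:
  assumes "\<And>n. n \<ge> 1 \<Longrightarrow> b n \<in> J" "u \<in> eisenstein_ints" "v \<in> eisenstein_ints"
  shows "cf_rec u v b n \<in> eisenstein_ints"
  using assms
  by (induction u v b n rule: cf_rec.induct)
    (auto intro!: eisenstein_ints_add eisenstein_ints_mult intro: J_subset_eisenstein)

text \<open>Prepending a digit amounts to running one step of the recursion on the initial
  values.\<close>

lemma cf_rec_Cons:
  "cf_rec u v (\<lambda>n. if n = 1 then d else b (n - 1)) (Suc n) = cf_rec v (d * v + u) b n"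
  by (induction n rule: induct_nat_012) auto

lemma cf_rec_linear:
  "cf_rec (c * u + c' * u') (c * v + c' * v') b n = c * cf_rec u v b n + c' * cf_rec u' v' b n"
  by (induction n rule: induct_nat_012) (simp_all add: algebra_simps)

lemma cf_rec_uminus: "cf_rec (- u) v (\<lambda>n. - b n) n = (- 1) ^ n * cf_rec u v b n"
  by (induction n rule: induct_nat_012) (simp_all add: algebra_simps)

text \<open>The error \<open>z - p/q\<close> equals \<open>(q * z - p) / q\<close>, a bounded
  numerator over an unbounded denominator.\<close>

lemma cf_expandableI:
  assumes J: "\<And>n. n \<ge> 1 \<Longrightarrow> b n \<in> J"
    and q: "filterlim (cf_q b) at_infinity sequentially"
    and e: "\<And>n. norm (cf_q b n * z - cf_p b n) \<le> 1"
  shows "cf_expandable z"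
proof -
  have nz: "\<forall>\<^sub>F n in sequentially. cf_q b n \<noteq> 0"
    using q by (rule filterlim_at_infinity_imp_eventually_ne)
  have "((\<lambda>n. inverse (cf_q b n)) \<longlongrightarrow> 0) sequentially"
    using q by (rule filterlim_compose[OF tendsto_inverse_0])
  hence lim: "(\<lambda>n. (cf_q b n * z - cf_p b n) * inverse (cf_q b n)) \<longlonglongrightarrow> 0"
    using e by (intro lim_null_mult_left_bounded[of _ 1]) auto
  have "(\<lambda>n. z - (cf_q b n * z - cf_p b n) * inverse (cf_q b n)) \<longlonglongrightarrow> z - 0"
    by (intro tendsto_intros lim)
  hence "(\<lambda>n. cf_p b n / cf_q b n) \<longlonglongrightarrow> z"
    unfolding diff_0_right
    by (rule Lim_transform_eventually)
      (use nz in \<open>eventually_elim, simp add: field_simps\<close>)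
  thus ?thesis
    using J nz unfolding cf_expandable_def by blast
qed

text \<open>Prepending \<open>d\<close> replaces each convergent \<open>p/q\<close> by
  \<open>1 / (d + p/q)\<close>, and inversion is continuous at \<open>inverse z \<noteq> 0\<close>.
  The contrapositive later passes inexpandability on to remainders.\<close>

lemma cf_expandable_step:
  assumes "cf_expandable w" "d \<in> J" "inverse z = d + w" "z \<noteq> 0"
  shows "cf_expandable z"
proof -
  obtain b where b: "\<And>n. n \<ge> 1 \<Longrightarrow> b n \<in> J" and nz: "\<forall>\<^sub>F n in sequentially. cf_q b n \<noteq> 0"
    and lim: "(\<lambda>n. cf_p b n / cf_q b n) \<longlonglongrightarrow> w"
    using assms(1) unfolding cf_expandable_def by blast
  define b' where "b' = (\<lambda>n. if n = 1 then d else b (n - 1))"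
  have p': "cf_p b' (Suc n) = cf_q b n" for n
    unfolding cf_p_def cf_q_def b'_def cf_rec_Cons by simp
  have q': "cf_q b' (Suc n) = d * cf_q b n + cf_p b n" for n
    unfolding cf_p_def cf_q_def b'_def cf_rec_Cons
    using cf_rec_linear[of d 0 1 1 1 0 b n] by simp
  have lim': "(\<lambda>n. d + cf_p b n / cf_q b n) \<longlonglongrightarrow> inverse z"
    unfolding assms(3) by (intro tendsto_intros lim)
  have "\<forall>\<^sub>F n in sequentially. d + cf_p b n / cf_q b n \<noteq> 0"
    using assms(4) by (intro tendsto_imp_eventually_ne[OF lim']) auto
  with nz have ev: "\<forall>\<^sub>F n in sequentially. cf_q b' (Suc n) \<noteq> 0 \<and>
      inverse (d + cf_p b n / cf_q b n) = cf_p b' (Suc n) / cf_q b' (Suc n)"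
    by eventually_elim (auto simp: p' q' field_simps)
  have "(\<lambda>n. inverse (d + cf_p b n / cf_q b n)) \<longlonglongrightarrow> inverse (inverse z)"
    using assms(4) by (intro tendsto_inverse lim') auto
  hence "(\<lambda>n. cf_p b' (Suc n) / cf_q b' (Suc n)) \<longlonglongrightarrow> z"
    unfolding inverse_inverse_eq
    by (rule Lim_transform_eventually) (use ev in \<open>eventually_elim, simp\<close>)
  hence "(\<lambda>n. cf_p b' n / cf_q b' n) \<longlonglongrightarrow> z"
    by (rule LIMSEQ_imp_Suc)
  moreover have "\<forall>\<^sub>F n in sequentially. cf_q b' n \<noteq> 0"
    using eventually_mono[OF ev, of "\<lambda>n. cf_q b' (Suc n) \<noteq> 0"]
    by (simp add: eventually_sequentially_Suc[of "\<lambda>n. cf_q b' n \<noteq> 0"])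
  moreover have "\<forall>n\<ge>1. b' n \<in> J"
    using b assms(2) by (auto simp: b'_def)
  ultimately show ?thesis
    unfolding cf_expandable_def by blast
qed

text \<open>Negating all digits changes \<open>p\<close> and \<open>q\<close> by opposite
  signs.\<close>

lemma cf_expandable_uminus:
  assumes "cf_expandable z"
  shows "cf_expandable (- z)"
proof -
  obtain b where b: "\<And>n. n \<ge> 1 \<Longrightarrow> b n \<in> J" and nz: "\<forall>\<^sub>F n in sequentially. cf_q b n \<noteq> 0"
    and lim: "(\<lambda>n. cf_p b n / cf_q b n) \<longlonglongrightarrow> z"
    using assms unfolding cf_expandable_def by blast
  define b' where "b' = (\<lambda>n. - b n)"
  have p: "cf_p b' n = - ((- 1) ^ n * cf_p b n)" for n
    using cf_rec_uminus[of "- 1" 0 b n] cf_rec_linear[of "- 1" 1 0 0 0 0 b n]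
    by (simp add: cf_p_def b'_def)
  have q: "cf_q b' n = (- 1) ^ n * cf_q b n" for n
    using cf_rec_uminus[of 0 1 b n] by (simp add: cf_q_def b'_def)
  have "(\<lambda>n. cf_p b' n / cf_q b' n) \<longlonglongrightarrow> - z"
    using tendsto_minus[OF lim] by (simp add: p q)
  moreover have "\<forall>\<^sub>F n in sequentially. cf_q b' n \<noteq> 0"
    using nz by (simp add: q)
  moreover have "\<forall>n\<ge>1. b' n \<in> J"
    using b J_uminus by (simp add: b'_def)
  ultimately show ?thesis
    unfolding cf_expandable_def by blast
qed

subsection \<open>Expansions of zero and of the vertices\<close>

lemma cf_expandable_0: "cf_expandable 0"
proof -
  define c where "c = 1 - omega"
  define b where "b = (\<lambda>n :: nat. if odd n then c else 0)"
  have c0: "c \<noteq> 0"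
    using Re_omega by (auto simp: c_def complex_eq_iff)
  have pq: "cf_p b (2 * k) = 0 \<and> cf_p b (Suc (2 * k)) = 1 \<and>
      cf_q b (2 * k) = 1 \<and> cf_q b (Suc (2 * k)) = of_nat (Suc k) * c" for k
    by (induction k) (auto simp: cf_p_def cf_q_def b_def algebra_simps)
  \<comment> \<open>The factor 2 comes from \<open>n + 1 = 2 * (k + 1)\<close> for
    \<open>n = 2 * k + 1\<close>.\<close>
  have bound: "norm (cf_p b n / cf_q b n) \<le> 2 * inverse (norm c) * inverse (of_nat (Suc n))" for n
  proof (cases "even n")
    case True
    then obtain k where "n = 2 * k" by blast
    thus ?thesis using pq[of k] by simp
  next
    case False
    then obtain k where n: "n = Suc (2 * k)" by (metis oddE Suc_eq_plus1)
    have Suc_n: "real (Suc n) = 2 * real (Suc k)"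
      by (simp add: n)
    have "cf_p b n / cf_q b n = inverse (of_nat (Suc k) * c)"
      using pq[of k] unfolding n by (metis inverse_eq_divide)
    hence "norm (cf_p b n / cf_q b n) = inverse (real (Suc k) * norm c)"
      by (simp only: norm_inverse norm_mult norm_of_nat)
    also have "\<dots> = 2 * inverse (norm c) * inverse (real (Suc n))"
      unfolding Suc_n inverse_mult_distrib by simp
    finally show ?thesis
      by simp
  qed
  have "(\<lambda>n. 2 * inverse (norm c) * inverse (of_nat (Suc n))) \<longlonglongrightarrow> 2 * inverse (norm c) * 0"
    by (intro tendsto_intros LIMSEQ_inverse_real_of_nat)
  hence "(\<lambda>n. cf_p b n / cf_q b n) \<longlonglongrightarrow> 0"
    by (intro Lim_null_comparison[OF always_eventually[OF allI[OF bound]]]) simp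
  moreover have "cf_q b n \<noteq> 0" for n
  proof -
    obtain k where "n = 2 * k \<or> n = Suc (2 * k)"
      by (metis evenE oddE Suc_eq_plus1)
    thus ?thesis
      using pq[of k] c0 by (elim disjE) (simp_all del: of_nat_Suc)
  qed
  moreover have "\<forall>n\<ge>1. b n \<in> J"
    using one_minus_omega_in_J J_0 by (simp add: b_def c_def)
  ultimately show ?thesis
    unfolding cf_expandable_def by (intro exI[of _ b]) auto
qed

text \<open>The remainders are \<open>z\<^sub>2\<^sub>k = \<omega>\<^sup>k\<close> and \<open>z\<^sub>2\<^sub>k\<^sub>+\<^sub>1 = \<omega>\<^sup>1\<^sup>-\<^sup>k\<close>.\<close>

lemma cf_expandable_1: "cf_expandable 1"
proof -
  \<comment> \<open>Each digit is the inverse of one remainder minus the next remainder; negative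
    exponents are removed by \<open>omega ^ 3 = 1\<close>.\<close>
  define b where "b = (\<lambda>n. if odd n then omega ^ (n - 1) * (1 - omega)
    else omega ^ (n div 2 - 1) * (omega\<^sup>2 - omega))"
  define g where "g = (\<lambda>k :: nat. 1 + of_nat k * (2 + omega))"
  have rec: "cf_rec u v b (2 * Suc k)
      = omega ^ k * (omega\<^sup>2 - omega) * cf_rec u v b (Suc (2 * k)) + cf_rec u v b (2 * k)"
    "cf_rec u v b (Suc (2 * Suc k))
      = (omega ^ k)\<^sup>2 * omega\<^sup>2 * (1 - omega) * cf_rec u v b (2 * Suc k) + cf_rec u v b (Suc (2 * k))"
    for u v k
    by (simp_all add: b_def power2_eq_square power_add mult_2)
  \<comment> \<open>In the coordinate \<open>1/(w - 1)\<close> the convergents are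
    \<open>- g k\<close> and \<open>- (g k - omega\<^sup>2)\<close>: every two digits translate by
    \<open>- eta\<close>.\<close>
  have pq: "cf_q b (2 * k) = (omega ^ k)\<^sup>2 * g k \<and>
      cf_q b (Suc (2 * k)) = - (omega ^ k * omega * (g k - omega\<^sup>2)) \<and>
      cf_p b (2 * k) = cf_q b (2 * k) - (omega ^ k)\<^sup>2 \<and>
      cf_p b (Suc (2 * k)) = cf_q b (Suc (2 * k)) + omega ^ k * omega" for k
  proof (induction k)
    case 0
    have "omega * (1 - omega\<^sup>2) = omega - 1"
      using omega_cube by algebra
    thus ?case
      by (simp add: cf_q_def cf_p_def b_def g_def)
  next
    case (Suc k)
    define W where "W = omega ^ k"
    have W: "W ^ 3 = 1"
      unfolding W_def by (metis omega_cube power_mult mult.commute power_one)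
    have W_Suc: "omega ^ Suc k = W * omega"
      by (simp add: W_def)
    note IH = Suc[folded W_def]
    have g: "g (Suc k) = g k + 2 + omega"
      by (simp add: g_def algebra_simps)
    note q_rec = rec[of 0 1 k, folded cf_q_def W_def] and p_rec = rec[of 1 0 k, folded cf_p_def W_def]
    \<comment> \<open>The odd-indexed digit and the preceding \<open>p\<close> and \<open>q\<close>
      each contribute the square of the cube root of unity \<open>W * omega\<close>.\<close>
    have W4: "(W * omega)\<^sup>2 * (W * omega)\<^sup>2 = W * omega"
    proof -
      have "(W * omega) ^ 3 = 1"
        using W omega_cube by (simp add: power_mult_distrib)
      moreover have "(W * omega)\<^sup>2 * (W * omega)\<^sup>2 = (W * omega) ^ 3 * (W * omega)"
        by (simp add: power2_eq_square power3_eq_cube mult.assoc)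
      ultimately show ?thesis
        by simp
    qed
    have q: "cf_q b (2 * Suc k) = (W * omega)\<^sup>2 * g (Suc k)"
    proof -
      have "W * (omega\<^sup>2 - omega) * - (W * omega * (g k - omega\<^sup>2)) + W\<^sup>2 * g k
          = (W * omega)\<^sup>2 * (g k + 2 + omega)"
        using omega_sq by algebra
      thus ?thesis
        using IH q_rec(1) g by simp
    qed
    have q': "cf_q b (Suc (2 * Suc k)) = - (W * omega * omega * (g (Suc k) - omega\<^sup>2))"
    proof -
      have "cf_q b (Suc (2 * Suc k)) = (W * omega)\<^sup>2 * (W * omega)\<^sup>2 * (1 - omega) * g (Suc k)
          - W * omega * (g k - omega\<^sup>2)"
        using IH q_rec(2) q by (simp add: power_mult_distrib mult_ac)
      also have "\<dots> = W * omega * ((1 - omega) * (g k + 2 + omega) - (g k - omega\<^sup>2))"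
        unfolding W4 g by (simp add: algebra_simps)
      also have "(1 - omega) * (g k + 2 + omega) - (g k - omega\<^sup>2)
          = - (omega * (g k + 2 + omega - omega\<^sup>2))"
        using omega_sq by algebra
      finally show ?thesis
        by (simp add: g mult.assoc)
    qed
    have p: "cf_p b (2 * Suc k) = cf_q b (2 * Suc k) - (W * omega)\<^sup>2"
    proof -
      have "W * (omega\<^sup>2 - omega) * (W * omega) - W\<^sup>2 = - ((W * omega)\<^sup>2)"
        using omega_sq by algebra
      moreover have "cf_p b (2 * Suc k)
          = cf_q b (2 * Suc k) + (W * (omega\<^sup>2 - omega) * (W * omega) - W\<^sup>2)"
        unfolding p_rec(1) q_rec(1) using IH by (simp add: algebra_simps)
      ultimately show ?thesis
        by simp
    qed
    have "cf_p b (Suc (2 * Suc k)) = cf_q b (Suc (2 * Suc k)) + W * omega * omega"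
    proof -
      have "cf_p b (Suc (2 * Suc k)) = cf_q b (Suc (2 * Suc k))
          - (W * omega)\<^sup>2 * (W * omega)\<^sup>2 * (1 - omega) + W * omega"
        unfolding p_rec(2) q_rec(2) p using IH by (simp add: algebra_simps power_mult_distrib)
      thus ?thesis
        unfolding W4 by (simp add: algebra_simps)
    qed
    with q q' p show ?case
      unfolding W_Suc by blast
  qed
  have "norm (cf_q b n * 1 - cf_p b n) \<le> 1" for n
  proof -
    obtain k where "n = 2 * k \<or> n = Suc (2 * k)"
      by (metis evenE oddE Suc_eq_plus1)
    thus ?thesis
      using pq[of k] by (elim disjE) (simp_all add: norm_power norm_mult norm_omega)
  qed
  \<comment> \<open>Up to a unit, \<open>q\<close> is \<open>g k\<close> or
    \<open>g k - omega\<^sup>2\<close>, whose real part grows by \<open>3/2\<close> with each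
    \<open>k\<close>.\<close>
  moreover have "real n / 2 \<le> norm (cf_q b n)" for n
  proof (cases "even n")
    case True
    then obtain k where n: "n = 2 * k" by blast
    have "real n / 2 \<le> Re (g k)"
      by (simp add: g_def n Re_omega)
    also have "\<dots> \<le> norm (g k)"
      by (rule complex_Re_le_cmod)
    finally show ?thesis
      using pq[of k] by (simp add: n norm_mult norm_power norm_omega)
  next
    case False
    then obtain k where n: "n = Suc (2 * k)" by (metis oddE Suc_eq_plus1)
    have "real n / 2 \<le> Re (g k - omega\<^sup>2)"
      by (simp add: g_def n Re_omega omega_sq)
    also have "\<dots> \<le> norm (g k - omega\<^sup>2)"
      by (rule complex_Re_le_cmod)
    finally show ?thesis
      using pq[of k] by (simp add: n norm_mult norm_power norm_omega)
  qed
  hence le: "1 / 2 * real n \<le> norm (cf_q b n)" for n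
    by simp
  have "filterlim (\<lambda>n. 1 / 2 * real n) at_top sequentially"
    by (rule filterlim_tendsto_pos_mult_at_top[OF tendsto_const _ filterlim_real_sequentially]) simp
  hence "filterlim (\<lambda>n. norm (cf_q b n)) at_top sequentially"
    using le by (rule filterlim_at_top_mono[OF _ always_eventually[OF allI]])
  hence "filterlim (cf_q b) at_infinity sequentially"
    by (rule filterlim_norm_at_top_imp_at_infinity)
  moreover have "b n \<in> J" for n
    unfolding b_def
    by (auto intro!: J_mult eisenstein_ints_power eisenstein_ints_omega
        one_minus_omega_in_J omega_sq_minus_omega_in_J)
  ultimately show ?thesis
    by (intro cf_expandableI[of b]) auto
qed

text \<open>For \<open>omega\<close> and \<open>omega\<^sup>2\<close> one digit leads to the
  remainder 1; negation gives the other vertices.\<close>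

lemma cf_expandable_vertices:
  assumes "z \<in> vertices"
  shows "cf_expandable z"
proof -
  have "cf_expandable omega"
  proof (rule cf_expandable_step[OF cf_expandable_1])
    have "omega\<^sup>2 - 1 = omega\<^sup>2 * (1 - omega)"
      using omega_sq by algebra
    thus "omega\<^sup>2 - 1 \<in> J"
      by (simp add: J_mult one_minus_omega_in_J eisenstein_ints_power eisenstein_ints_omega)
    have "omega * omega\<^sup>2 = 1"
      using omega_cube by algebra
    thus "inverse omega = omega\<^sup>2 - 1 + 1"
      by (simp add: inverse_unique)
    show "omega \<noteq> 0"
      using norm_omega by auto
  qed
  moreover have "cf_expandable (omega\<^sup>2)"
  proof (rule cf_expandable_step[OF cf_expandable_1])
    show "- (1 - omega) \<in> J"
      by (intro J_uminus one_minus_omega_in_J)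
    show "inverse (omega\<^sup>2) = - (1 - omega) + 1"
    proof -
      have "omega\<^sup>2 * omega = 1"
        using omega_cube by algebra
      thus ?thesis
        by (simp add: inverse_unique)
    qed
    show "omega\<^sup>2 \<noteq> 0"
      using norm_omega by auto
  qed
  ultimately show ?thesis
    using assms cf_expandable_1 cf_expandable_uminus by (auto simp: vertices_def)
qed

subsection \<open>The generic case\<close>

text \<open>The norms of the remainders may approach 1, so there is no contraction factor;
  discreteness of the Eisenstein integers replaces it.\<close>

lemma cf_expandable_if_remainders:
  fixes y :: "nat \<Rightarrow> complex"
  assumes y: "\<And>n. y n \<noteq> 0" "\<And>n. norm (y n) < 1"
    and J: "\<And>n. inverse (y n) - y (Suc n) \<in> J"
  shows "cf_expandable (y 0)"
proof -
  define b where "b = (\<lambda>n. inverse (y (n - 1)) - y n)"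
  define e where "e = (\<lambda>n. cf_q b n * y 0 - cf_p b n)"
  have bJ: "b n \<in> J" if "n \<ge> 1" for n
    using J[of "n - 1"] that by (simp add: b_def)
  have rec: "e (Suc (Suc n)) = b (Suc (Suc n)) * e (Suc n) + e n" for n
    by (simp add: e_def cf_q_def cf_p_def algebra_simps)
  \<comment> \<open>By induction: \<open>b (n + 2) = 1 / y (n + 1) - y (n + 2)\<close>, and the
    first summand times \<open>e (n + 1)\<close> cancels \<open>e n\<close>.\<close>
  have e_Suc: "e (Suc n) = - (y (Suc n) * e n)" for n
  proof (induction n)
    case 0
    show ?case
      using y(1) by (simp add: e_def b_def cf_q_def cf_p_def field_simps)
  next
    case (Suc n)
    show ?case
      unfolding rec Suc.IH using y(1) by (simp add: b_def field_simps)
  qed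
  have e_0: "e 0 = y 0"
    by (simp add: e_def cf_q_def cf_p_def)
  have e_nz: "e n \<noteq> 0" for n
    by (induction n) (auto simp: e_0 e_Suc y)
  have less: "norm (e (Suc n)) < norm (e n)" for n
    using y(2)[of "Suc n"] e_nz[of n] by (simp add: e_Suc norm_mult)
  have anti: "norm (e n) < norm (e m)" if "m < n" for m n
    using lift_Suc_mono_less[of "\<lambda>n. - norm (e n)" m n] less that by simp
  have le: "norm (e n) \<le> 1" for n
    using anti[of 0 n] y(2)[of 0] by (cases n) (auto simp: e_0)
  have inj: "inj (\<lambda>n. (cf_p b n, cf_q b n))"
  proof (rule linorder_injI)
    fix m n :: nat assume "m < n"
    thus "(cf_p b m, cf_q b m) \<noteq> (cf_p b n, cf_q b n)"
      using anti[of m n] by (auto simp: e_def)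
  qed
  have ints: "cf_p b n \<in> eisenstein_ints" "cf_q b n \<in> eisenstein_ints" for n
    unfolding cf_p_def cf_q_def
    using bJ by (intro cf_rec_in_eisenstein_ints eisenstein_ints_0 eisenstein_ints_1; simp)+
  have "filterlim (\<lambda>n. norm (cf_q b n)) at_top sequentially"
    unfolding filterlim_at_top
  proof
    fix R :: real
    \<comment> \<open>A bound on \<open>q\<close> bounds \<open>p\<close> as well, because
      \<open>q * y 0 - p\<close> has norm at most 1; injectivity leaves finitely many
      indices.\<close>
    define S where "S = (\<lambda>n. (cf_p b n, cf_q b n)) -`
      ({x \<in> eisenstein_ints. norm x \<le> \<bar>R\<bar> + 1} \<times> {x \<in> eisenstein_ints. norm x \<le> R})"
    have "finite S"
      unfolding S_def by (intro finite_vimageI inj finite_cartesian_product finite_eisenstein_ints_norm_le)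
    moreover have "n \<in> S" if "norm (cf_q b n) < R" for n
    proof -
      have "norm (cf_p b n) \<le> norm (cf_q b n * y 0) + norm (e n)"
        unfolding e_def by (metis norm_triangle_sub norm_minus_commute)
      also have "\<dots> \<le> norm (cf_q b n) * 1 + 1"
        unfolding norm_mult using y(2)[of 0] le[of n] by (intro add_mono mult_left_mono) auto
      finally show ?thesis
        using that ints by (auto simp: S_def)
    qed
    ultimately have "finite {n. norm (cf_q b n) < R}"
      by (metis (mono_tags, lifting) finite_subset mem_Collect_eq subsetI)
    hence "\<forall>\<^sub>F n in cofinite. \<not> norm (cf_q b n) < R"
      by (simp add: eventually_cofinite)
    thus "\<forall>\<^sub>F n in sequentially. R \<le> norm (cf_q b n)"
      by (simp add: cofinite_eq_sequentially not_less)
  qed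
  hence "filterlim (cf_q b) at_infinity sequentially"
    by (rule filterlim_norm_at_top_imp_at_infinity)
  thus ?thesis
    using bJ le unfolding e_def by (intro cf_expandableI[of b]) auto
qed

text \<open>Arguing by contradiction removes terminating expansions: the remainders of an
  inexpandable point are again inexpandable, hence never 0 or a vertex.\<close>

lemma cf_expandable_hexagon:
  assumes "norm z < 1 \<or> z \<in> vertices"
  shows "cf_expandable z"
proof (rule ccontr)
  assume z: "\<not> cf_expandable z"
  define X where "X = {w. norm w < 1 \<and> \<not> cf_expandable w}"
  have nz: "w \<noteq> 0" if "w \<in> X" for w
    using that cf_expandable_0 by (auto simp: X_def)
  have "\<exists>w'. w' \<in> X \<and> inverse w - w' \<in> J" if "w \<in> X" for w
  proof -
    obtain b where b: "b \<in> J" "norm (inverse w - b) < 1 \<or> inverse w - b \<in> vertices"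
      using exists_remainder by blast
    have "\<not> cf_expandable (inverse w - b)"
      using cf_expandable_step[of "inverse w - b" b w] b(1) nz[OF that] that by (auto simp: X_def)
    thus ?thesis
      using b cf_expandable_vertices by (intro exI[of _ "inverse w - b"]) (auto simp: X_def)
  qed
  moreover have "z \<in> X"
    using z assms cf_expandable_vertices by (auto simp: X_def)
  ultimately obtain y where y: "y 0 = z" "\<And>n. y n \<in> X" "\<And>n. inverse (y n) - y (Suc n) \<in> J"
    \<comment> \<open>The clause for \<open>n = 0\<close> forces the chosen sequence to start at
      \<open>z\<close>.\<close>
    using dependent_nat_choice[of "\<lambda>n w. w \<in> X \<and> (n = 0 \<longrightarrow> w = z)" "\<lambda>n w w'. inverse w - w' \<in> J"]
    by auto
  have "cf_expandable (y 0)"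
    using y nz by (intro cf_expandable_if_remainders) (auto simp: X_def)
  thus False
    using z y(1) by simp
qed

theorem theorem1:
  fixes z :: complex
  assumes "z \<in> U"
  shows "\<exists>b :: nat \<Rightarrow> complex. (\<forall>n\<ge>1. b n \<in> J) \<and>
           (\<forall>\<^sub>F n in sequentially. cf_q b n \<noteq> 0) \<and>
           (\<lambda>n. cf_p b n / cf_q b n) \<longlonglongrightarrow> z"
  using cf_expandable_hexagon[OF U_subset[OF assms]] unfolding cf_expandable_def .

end
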